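(* Let $\mathcal{A}$ be an arborescence with rank function $\rho$. Let $M_{\mathcal{A}}$ be the set of functions \[ \{f\colon \mathcal{A}\to \mathbb{N} \mid f \text{ is order-preserving and } f(x)\leq \rho(x) \text{ for all } x\in\mathcal{A}\},\] partially ordered by $f\leq g$ if and only if $f(x)\leq g(x)$ for all $x\in\mathcal{A}$. Then the map $\Delta_{\mathcal{A}}\colon \operatorname{Tr}(\mathcal{A})\to M_{\mathcal{A}}$ is an order-reversing bijection.
   Context: $\mathbb{N}$ contains $0$. Arborescence: a finite poset $\mathcal{A}$ whose Hasse diagram (the graph of covering relations) is a rooted tree whose root is the unique minimal element $\bot$, equipped with the rank function $\rho\colon\mathcal{A}\to\mathbb{N}$ sending $x$ to the number of edges in the unique path in the Hasse diagram from $\bot$ to $x$. Transfer system: for a finite poset $(\mathcal{P},\leq)$, a transfer system on $\mathcal{P}$ is a reflexive and transitive relation $R$ on $\mathcal{P}$ such that (1) $x\,R\,y$ implies $x\leq y$; and (2) for all $x,y,z\in\mathcal{P}$, if $x\,R\,z$ and $y\leq z$, then $m\,R\,y$ for every maximal element $m$ of $\{p\in \mathcal{P} : p\leq x \text{ and } p\leq y\}$. $\operatorname{Tr}(\mathcal{P})$ is the set of transfer systems on $\mathcal{P}$, partially ordered by inclusion of relations. For $R\in\operatorname{Tr}(\mathcal{A})$ define $\delta_{\mathcal{A}}(R)\colon\mathcal{A}\to\mathbb{N}$ by $\delta_{\mathcal{A}}(R)(x)=\#\{y\in\mathcal{A} \mid y\,R\,x\}-1$, and $\Delta_{\mathcal{A}}(R)\colon\mathcal{A}\to\mathbb{N}$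 by $\Delta_{\mathcal{A}}(R)(x)=\rho(x)-\delta_{\mathcal{A}}(R)(x)$. A map $F$ of posets is order-reversing if $a\leq b$ implies $F(a)\geq F(b)$ (the inverse of an order-reversing bijection is not required to be order-reversing). *)

theory Defs
  imports "Graph_Theory.Graph_Theory"
begin

definition maximal_in :: "'a::order set \<Rightarrow> 'a \<Rightarrow> bool" where
  "maximal_in S m \<longleftrightarrow> m \<in> S \<and> (\<forall>p\<in>S. m \<le> p \<longrightarrow> p = m)"

definition minimal_in :: "'a::order set \<Rightarrow> 'a \<Rightarrow> bool" where
  "minimal_in S m \<longleftrightarrow> m \<in> S \<and> (\<forall>p\<in>S. p \<le> m \<longrightarrow> p = m)"

definition covered_by :: "'a::order \<Rightarrow> 'a \<Rightarrow> bool" where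
  "covered_by x y \<longleftrightarrow> x < y \<and> (\<nexists>z. x < z \<and> z < y)"

text \<open>The Hasse diagram as an undirected graph: each edge is represented by its two opposite arcs.\<close>

definition hasse :: "('a::order, 'a \<times> 'a) pre_digraph" where
  "hasse = with_proj \<lparr>pverts = UNIV, parcs = {(x, y). covered_by x y \<or> covered_by y x}\<rparr>"

text \<open>
  Connected and acyclic, for a symmetric loop-free digraph without parallel arcs representing
  an undirected graph. The constant \<^const>\<open>tree\<close> is not usable here: \<^const>\<open>forest\<close> forbids
  all directed cycles, including those of length 2 formed by the two arcs of a single edge.
  The directed cycles of length at least 3 are exactly the cycles of the undirected graph.
\<close>

definition undirected_tree :: "('a, 'b) pre_digraph \<Rightarrow> bool" where
  "undirected_tree G \<longleftrightarrow>
     connected G \<and> \<not> (\<exists>c. pre_digraph.cycle G c \<and> 3 \<le> length c)"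

definition arborescence :: "'a::{finite,order} \<Rightarrow> bool" where
  "arborescence r \<longleftrightarrow>
     undirected_tree (hasse :: ('a, 'a \<times> 'a) pre_digraph) \<and>
     (\<forall>x::'a. minimal_in UNIV x \<longleftrightarrow> x = r)"

text \<open>Walks are lists of arcs, so \<^const>\<open>length\<close> counts edges.\<close>

definition hasse_rank :: "'a::{finite,order} \<Rightarrow> 'a \<Rightarrow> nat" where
  "hasse_rank r x = length (THE p. pre_digraph.apath hasse r p x)"

definition transfer_system :: "'a::{finite,order} rel \<Rightarrow> bool" where
  "transfer_system R \<longleftrightarrow> refl R \<and> trans R \<and>
     (\<forall>x y. (x, y) \<in> R \<longrightarrow> x \<le> y) \<and>
     (\<forall>x y z. (x, z) \<in> R \<and> y \<le> z \<longrightarrow>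
        (\<forall>m. maximal_in {p. p \<le> x \<and> p \<le> y} m \<longrightarrow> (m, y) \<in> R))"

definition Tr :: "'a::{finite,order} rel set" where
  "Tr = {R. transfer_system R}"

definition delta :: "'a::{finite,order} rel \<Rightarrow> 'a \<Rightarrow> nat" where
  "delta R x = card {y. (y, x) \<in> R} - 1"

text \<open>
  Subtraction on \<^typ>\<open>nat\<close> truncates; that no truncation occurs on \<^const>\<open>Tr\<close> is part of the
  assertion that the values of \<open>Delta\<close> are natural numbers and has to be stated separately.
\<close>

definition Delta :: "'a::{finite,order} \<Rightarrow> 'a rel \<Rightarrow> 'a \<Rightarrow> nat" where
  "Delta r R x = hasse_rank r x - delta R x"

definition M_arb :: "'a::{finite,order} \<Rightarrow> ('a \<Rightarrow> nat) set" where
  "M_arb r = {f. mono f \<and> (\<forall>x. f x \<le> hasse_rank r x)}"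

end

theory Submission
  imports Defs
begin

text \<open>
  In an arborescence every principal down-set is a chain, since two incomparable elements below a
  common bound would close a cycle in the Hasse diagram. So \<open>\<rho>(x)\<close> is the number of elements
  strictly below \<open>x\<close>, and the second axiom of a transfer system says that \<open>x R z\<close> implies \<open>x R y\<close>
  whenever \<open>x \<le> y \<le> z\<close>. Hence \<open>\<Delta>(R)(x)\<close> counts the \<open>y < x\<close> that are not related to \<open>x\<close>, a set
  that grows with \<open>x\<close> and shrinks as \<open>R\<close> grows.

  If two transfer systems agree strictly below \<open>x\<close>, the sets of their predecessors of \<open>x\<close> are
  comparable by inclusion, so they are determined by their cardinalities; this gives injectivity.
  For surjectivity, view \<open>d = \<rho> - f\<close> as the height of a stack along the chain below \<open>x\<close>: each step
  upwards in the tree pushes the element just left and then pops some elements. The elements on the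
  stack at \<open>x\<close> are the \<open>y < x\<close> with \<open>d(y) < d(w)\<close> for all \<open>w\<close> in \<open>(y, x]\<close>, and this relation is a
  transfer system mapped to \<open>f\<close>.
\<close>

section \<open>The Hasse diagram of an arborescence\<close>

lemma hasse_simps [simp]:
  "verts hasse = UNIV"
  "arcs hasse = {(x, y). covered_by x y \<or> covered_by y x}"
  "tail hasse = fst"
  "head hasse = snd"
  by (simp_all add: hasse_def with_proj_def)

interpretation hasse: wf_digraph hasse
  by (rule wf_digraph.intro) simp_all

section \<open>Covers and monotone paths in a finite order\<close>

lemma finite_less_induct [case_names less]:
  fixes x :: "'a::{finite,order}"
  assumes "\<And>x. (\<And>y. y < x \<Longrightarrow> P y) \<Longrightarrow> P x"
  shows "P x"
proof (induction "card {..<x}" arbitrary: x rule: less_induct)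
  case less
  show ?case
  proof (rule assms)
    fix y assume "y < x"
    then have "{..<y} \<subset> {..<x}" by auto
    then show "P y" by (intro less psubset_card_mono) simp_all
  qed
qed

lemma covered_by_less: "covered_by x y \<Longrightarrow> x < y"
  by (simp add: covered_by_def)

lemma ex_lower_cover:
  fixes x y :: "'a::{finite,order}"
  assumes "x < y"
  obtains z where "x \<le> z" "covered_by z y"
proof -
  obtain z where z: "z \<in> {z. x \<le> z \<and> z < y}" "\<And>w. w \<in> {z. x \<le> z \<and> z < y} \<Longrightarrow> z \<le> w \<Longrightarrow> z = w"
    using finite_has_maximal[of "{z. x \<le> z \<and> z < y}"] assms by auto
  then have "covered_by z y"
    unfolding covered_by_def by (auto simp: order_less_le intro: order_trans)
  with z that show ?thesis by blast
qed

lemma ex_upper_cover: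
  fixes x y :: "'a::{finite,order}"
  assumes "x < y"
  obtains z where "covered_by x z" "z \<le> y"
proof -
  obtain z where z: "z \<in> {z. x < z \<and> z \<le> y}" "\<And>w. w \<in> {z. x < z \<and> z \<le> y} \<Longrightarrow> w \<le> z \<Longrightarrow> z = w"
    using finite_has_minimal[of "{z. x < z \<and> z \<le> y}"] assms by auto
  then have "covered_by x z"
    unfolding covered_by_def by (auto simp: order_less_le intro: order_trans)
  with z that show ?thesis by blast
qed

text \<open>Keeping the vertices inside the interval allows such paths to be glued into a cycle
  later; it also shows that the path to a lower cover of y does not visit y.\<close>

lemma hasse_walk_up:
  fixes x y :: "'a::{finite,order}"
  assumes "x \<le> y"
  shows "\<exists>p. hasse.apath x p y \<and> set (hasse.awalk_verts x p) \<subseteq> {x..y}"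
  using assms
proof (induction y rule: finite_less_induct)
  case (less y)
  show ?case
  proof (cases "x = y")
    case True
    then show ?thesis by (intro exI[of _ "[]"]) (simp add: hasse.apath_Nil_iff)
  next
    case False
    then obtain z where z: "x \<le> z" "covered_by z y"
      using less.prems ex_lower_cover order_less_le by metis
    then have "z < y" by (simp add: covered_by_less)
    with less.IH z obtain p where
      p: "hasse.apath x p z" "set (hasse.awalk_verts x p) \<subseteq> {x..z}" by blast
    have px: "hasse.awalk x p z" using p(1) by (simp add: hasse.apath_def)
    then have last: "hasse.awlast x p = z" by auto
    have walk: "hasse.awalk x (p @ [(z, y)]) y"
      using px z(2) by (simp add: last hasse.awalk_Cons_iff hasse.awalk_Nil_iff)
    have "hasse.awalk_verts x (p @ [(z, y)]) = hasse.awalk_verts x p @ [y]"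
      using hasse.awalk_verts_append[OF walk] by simp
    moreover have "{x..z} \<subseteq> {x..y}" "y \<notin> {x..z}"
      using \<open>z < y\<close> by auto
    then have "set (hasse.awalk_verts x p) \<subseteq> {x..y}" "y \<notin> set (hasse.awalk_verts x p)"
      using p(2) by (metis subset_trans, metis subsetD)
    ultimately show ?thesis
      using p(1) walk less.prems by (intro exI[of _ "p @ [(z, y)]"]) (simp add: hasse.apath_def)
  qed
qed

lemma hasse_walk_down:
  fixes x y :: "'a::{finite,order}"
  assumes "x \<le> y"
  shows "\<exists>p. hasse.apath y p x \<and> set (hasse.awalk_verts y p) \<subseteq> {x..y}"
  using assms
proof (induction y rule: finite_less_induct)
  case (less y)
  show ?case
  proof (cases "x = y")
    case True
    then show ?thesis by (intro exI[of _ "[]"]) (simp add: hasse.apath_Nil_iff)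
  next
    case False
    then obtain z where z: "x \<le> z" "covered_by z y"
      using less.prems ex_lower_cover order_less_le by metis
    then have "z < y" by (simp add: covered_by_less)
    with less.IH z obtain p where
      p: "hasse.apath z p x" "set (hasse.awalk_verts z p) \<subseteq> {x..z}" by blast
    have "{x..z} \<subseteq> {x..y}" "y \<notin> {x..z}"
      using \<open>z < y\<close> by auto
    then have "set (hasse.awalk_verts z p) \<subseteq> {x..y}" "y \<notin> set (hasse.awalk_verts z p)"
      using p(2) by (metis subset_trans, metis subsetD)
    then show ?thesis
      using p(1) z(2) less.prems by (intro exI[of _ "(y, z) # p"]) (simp add: hasse.apath_Cons_iff)
  qed
qed

section \<open>Tree structure: the elements below a point form a chain\<close>

context
  fixes r :: "'a::{finite,order}"
  assumes arb: "arborescence r"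
begin

lemma root_le: "r \<le> x"
proof -
  obtain m where m: "m \<in> {..x}" "\<And>w. w \<in> {..x} \<Longrightarrow> w \<le> m \<Longrightarrow> m = w"
    using finite_has_minimal2[of "{..x}" x] by auto
  then have "minimal_in UNIV m"
    unfolding minimal_in_def by (metis UNIV_I atMost_iff order_trans)
  with arb m show ?thesis by (auto simp: arborescence_def)
qed

text \<open>Otherwise a cycle runs from a maximal common lower bound m up to a, over x to b, and
  down to m. Maximality of m makes the two sides meet only in m.\<close>

lemma lower_cover_unique:
  assumes ax: "covered_by (a::'a) x" and bx: "covered_by b x"
  shows "a = b"
proof (rule ccontr)
  assume "a \<noteq> b"
  then have nle: "\<not> a \<le> b" "\<not> b \<le> a"
    using ax bx by (auto simp: covered_by_def order_less_le)
  obtain m where m: "m \<le> a" "m \<le> b" and mmax: "\<And>w. w \<le> a \<Longrightarrow> w \<le> b \<Longrightarrow> m \<le> w \<Longrightarrow> m = w"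
    using finite_has_maximal2[of "{w. w \<le> a \<and> w \<le> b}" r] root_le by auto
  obtain p where p: "hasse.apath m p a" "set (hasse.awalk_verts m p) \<subseteq> {m..a}"
    using hasse_walk_up[OF m(1)] by blast
  obtain q where q: "hasse.apath b q m" "set (hasse.awalk_verts b q) \<subseteq> {m..b}"
    using hasse_walk_down[OF m(2)] by blast
  have last: "hasse.awlast m p = a" using p(1) by (auto simp: hasse.apath_def)
  let ?c = "p @ (a, x) # (x, b) # q"
  have walk: "hasse.awalk m ?c m"
    using p(1) q(1) ax bx by (simp add: last hasse.apath_def hasse.awalk_Cons_iff)
  \<comment> \<open>A cycle needs distinct vertices only after the first is dropped, since m is both
    start and end.\<close>
  have "tl (hasse.awalk_verts m ?c) = tl (hasse.awalk_verts m p) @ x # hasse.awalk_verts b q"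
    using hasse.awalk_verts_append[OF walk] by simp
  moreover have "hasse.awalk_verts m p = m # tl (hasse.awalk_verts m p)"
    using p(1) by (metis hasse.apath_def hasse.awalkE hasse.awalk_verts_non_Nil list.collapse)
  then have "distinct (tl (hasse.awalk_verts m p))" "m \<notin> set (tl (hasse.awalk_verts m p))"
     "set (tl (hasse.awalk_verts m p)) \<subseteq> {m..a}"
    using p by (metis distinct.simps(2) hasse.apath_def, metis distinct.simps(2) hasse.apath_def,
      metis set_subset_Cons subset_trans)
  moreover from this have "set (tl (hasse.awalk_verts m p)) \<inter> set (hasse.awalk_verts b q) = {}"
    using q(2) mmax by fastforce
  moreover have "x \<notin> {m..a}" "x \<notin> {m..b}"
    using ax bx by (auto dest: covered_by_less)
  ultimately have "distinct (tl (hasse.awalk_verts m ?c))"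
    using q by (auto simp: hasse.apath_def)
  with walk have "hasse.cycle ?c" by (auto simp: hasse.cycle_def)
  \<comment> \<open>m = a would give a \<le> b, so at least one arc precedes the two arcs at
    x.\<close>
  moreover have "p \<noteq> []" using p(1) nle m by (auto simp: hasse.apath_Nil_iff)
  then have "3 \<le> length ?c" by (cases p) auto
  ultimately show False
    using arb unfolding arborescence_def undirected_tree_def by blast
qed

text \<open>Elements strictly below x lie below its only lower cover, so the claim descends to that
  cover.\<close>

lemma comparable_below:
  assumes "(a::'a) \<le> x" "b \<le> x"
  shows "a \<le> b \<or> b \<le> a"
  using assms
proof (induction x rule: finite_less_induct)
  case (less x)
  show ?case
  proof (cases "a = x \<or> b = x")
    case True
    with less.prems show ?thesis by auto
  next
    case False
    with less.prems have "a < x" "b < x" by (auto simp: order_less_le)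
    obtain a' where a': "a \<le> a'" "covered_by a' x" by (rule ex_lower_cover[OF \<open>a < x\<close>])
    obtain b' where b': "b \<le> b'" "covered_by b' x" by (rule ex_lower_cover[OF \<open>b < x\<close>])
    have "a' = b'" using a'(2) b'(2) by (rule lower_cover_unique)
    with less.IH[OF covered_by_less[OF a'(2)]] a' b' show ?thesis by simp
  qed
qed

lemma lessThan_cover:
  assumes "covered_by (y::'a) w"
  shows "{..<w} = insert y {..<y}"
proof -
  have "z \<le> y" if "z < w" for z
    using that assms comparable_below[of z w y] unfolding covered_by_def
    by (metis order_less_le)
  moreover have "z < w" if "z \<le> y" for z
    using that covered_by_less[OF assms] by (rule order_le_less_trans)
  ultimately show ?thesis
    unfolding set_eq_iff insert_iff lessThan_iff by (metis order_le_less)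
qed

lemma card_lessThan_cover: "covered_by (y::'a) w \<Longrightarrow> card {..<w} = Suc (card {..<y})"
  by (simp add: lessThan_cover[of y w])

section \<open>Paths from the root and the rank\<close>

text \<open>The only downward arc at v leads back to u, which the path avoids; so after one
  ascending arc a path can never turn down.\<close>

lemma apath_ascending:
  assumes "hasse.apath v p x" "covered_by (u::'a) v" "u \<notin> set (hasse.awalk_verts v p)"
  shows "\<forall>(a, b)\<in>set p. covered_by a b"
  using assms
proof (induction p arbitrary: u v)
  case (Cons e p)
  obtain w where e: "e = (v, w)"
    using Cons.prems(1) by (cases e) (auto simp: hasse.apath_Cons_iff)
  have p: "hasse.apath w p x" "v \<notin> set (hasse.awalk_verts w p)" "covered_by v w \<or> covered_by w v"
    using Cons.prems(1) by (auto simp: hasse.apath_Cons_iff e)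
  have "w \<in> set (hasse.awalk_verts w p)"
    using p(1) by (rule hasse.hd_in_awalk_verts)
  then have "\<not> covered_by w v"
    using lower_cover_unique[OF Cons.prems(2)] Cons.prems(3) by (auto simp: e)
  with p Cons.IH[OF p(1)] e show ?case by auto
qed simp

lemma apath_root_ascending:
  assumes "hasse.apath r p x"
  shows "\<forall>(a, b)\<in>set p. covered_by a b"
proof (cases p)
  case (Cons e q)
  obtain w where e: "e = (r, w)"
    using assms Cons by (cases e) (auto simp: hasse.apath_Cons_iff)
  have q: "hasse.apath w q x" "r \<notin> set (hasse.awalk_verts w q)" "covered_by r w \<or> covered_by w r"
    using assms by (auto simp: hasse.apath_Cons_iff e Cons)
  then have "covered_by r w"
    using root_le[of w] by (auto simp: covered_by_def less_le_not_le)
  with apath_ascending[OF q(1) _ q(2)] show ?thesis by (auto simp: Cons e)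
qed simp

text \<open>The last arc is forced, as it starts at the unique lower cover of x; hence the induction
  from the end of the walk.\<close>

lemma ascending_walk_unique:
  assumes "hasse.awalk r p x" "\<forall>(a, b)\<in>set p. covered_by a b"
    and "hasse.awalk r q x" "\<forall>(a, b)\<in>set q. covered_by a b"
  shows "p = q"
  using assms
proof (induction p arbitrary: q x rule: rev_induct)
  case Nil
  then have "x = r" by (simp add: hasse.awalk_Nil_iff)
  show ?case
  proof (cases q rule: rev_cases)
    case (snoc q' e)
    with Nil.prems \<open>x = r\<close> have "covered_by (fst e) r"
      by (auto simp: hasse.awalk_Cons_iff hasse.awalk_Nil_iff split: prod.splits)
    then show ?thesis using root_le by (auto dest: covered_by_less simp: less_le_not_le)
  qed simp
next
  case (snoc e p)
  then have e: "hasse.awalk r p (fst e)" "snd e = x" "covered_by (fst e) x"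
    by (auto simp: hasse.awalk_Cons_iff hasse.awalk_Nil_iff)
  show ?case
  proof (cases q rule: rev_cases)
    case Nil
    with snoc.prems have "x = r" by (simp add: hasse.awalk_Nil_iff)
    with e show ?thesis using root_le by (auto dest: covered_by_less simp: less_le_not_le)
  next
    case q: (snoc q' e')
    then have e': "hasse.awalk r q' (fst e')" "snd e' = x" "covered_by (fst e') x"
      using snoc.prems by (auto simp: hasse.awalk_Cons_iff hasse.awalk_Nil_iff)
    then have "e' = e"
      using e lower_cover_unique by (simp add: prod_eq_iff)
    with snoc e e' q show ?thesis by auto
  qed
qed

lemma ascending_walk_length:
  assumes "hasse.awalk r p x" "\<forall>(a, b)\<in>set p. covered_by a b"
  shows "length p = card {..<x}"
  using assms
proof (induction p arbitrary: x rule: rev_induct)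
  case Nil
  then have "x = r" by (simp add: hasse.awalk_Nil_iff)
  then have "{..<x} = {}" using root_le by (auto simp: less_le_not_le)
  then show ?case by (metis card.empty list.size(3))
next
  case (snoc e p)
  then have "hasse.awalk r p (fst e)" "covered_by (fst e) x"
    by (auto simp: hasse.awalk_Cons_iff hasse.awalk_Nil_iff)
  with snoc show ?case by (simp add: card_lessThan_cover)
qed

text \<open>The path described in \<open>hasse_rank\<close> is well defined: a path from the root
  exists, must ascend, and is therefore unique.\<close>

lemma hasse_rank_eq_card: "hasse_rank r x = card {..<x}"
proof -
  obtain p where p: "hasse.apath r p x"
    using hasse_walk_up[OF root_le] by blast
  have "(THE p. hasse.apath r p x) = p"
    using p
    by (intro the_equality)
      (metis apath_root_ascending ascending_walk_unique hasse.apath_def)+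
  with p show ?thesis
    using apath_root_ascending ascending_walk_length by (simp add: hasse_rank_def hasse.apath_def)
qed

section \<open>Transfer systems on an arborescence\<close>

text \<open>Below z, x and y are comparable, so the smaller of the two is the greatest common lower
  bound. For y \<le> x the second axiom only asserts reflexivity at y; for x \<le> y it is
  restriction.\<close>

lemma transfer_system_iff:
  "R \<in> Tr \<longleftrightarrow> refl R \<and> trans R \<and> (\<forall>x (y::'a). (x, y) \<in> R \<longrightarrow> x \<le> y) \<and>
     (\<forall>x y z. (x, z) \<in> R \<and> x \<le> y \<and> y \<le> z \<longrightarrow> (x, y) \<in> R)"
proof -
  define restricts where
    "restricts x y \<longleftrightarrow> (\<forall>m. maximal_in {p. p \<le> x \<and> p \<le> y} m \<longrightarrow> (m, y) \<in> R)" for x y :: 'a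
  have restricts_iff: "restricts x y \<longleftrightarrow> (x \<le> y \<longrightarrow> (x, y) \<in> R)"
    if "refl R" "x \<le> z" "y \<le> z" for x y z :: 'a
  proof (cases "x \<le> y")
    case True
    then have "maximal_in {p. p \<le> x \<and> p \<le> y} m \<longleftrightarrow> m = x" for m
      unfolding maximal_in_def by (auto intro: antisym)
    with True show ?thesis by (simp add: restricts_def)
  next
    case False
    with comparable_below[of x z y] that have "y \<le> x" by auto
    then have "maximal_in {p. p \<le> x \<and> p \<le> y} m \<longleftrightarrow> m = y" for m
      unfolding maximal_in_def by (auto intro: antisym)
    with False that show ?thesis by (simp add: restricts_def refl_onD)
  qed
  show ?thesis
    unfolding Tr_def transfer_system_def mem_Collect_eq restricts_def[symmetric]
    using restricts_iff by metis
qed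

lemma Tr_refl: "R \<in> Tr \<Longrightarrow> (x::'a, x) \<in> R"
  unfolding transfer_system_iff by (metis UNIV_I refl_onD)

lemma Tr_le: "R \<in> Tr \<Longrightarrow> (x::'a, y) \<in> R \<Longrightarrow> x \<le> y"
  unfolding transfer_system_iff by metis

lemma Tr_trans: "R \<in> Tr \<Longrightarrow> (x::'a, y) \<in> R \<Longrightarrow> (y, z) \<in> R \<Longrightarrow> (x, z) \<in> R"
  unfolding transfer_system_iff by (metis transD)

lemma Tr_restrict: "R \<in> Tr \<Longrightarrow> (x::'a, z) \<in> R \<Longrightarrow> x \<le> y \<Longrightarrow> y \<le> z \<Longrightarrow> (x, y) \<in> R"
  unfolding transfer_system_iff by metis

text \<open>The 1 subtracted in \<open>delta\<close> accounts for the reflexive pair at x.\<close>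

lemma Tr_delta_eq_card:
  assumes R: "R \<in> Tr"
  shows "delta R (x::'a) = card {y. y < x \<and> (y, x) \<in> R}"
proof -
  have "{y. (y, x) \<in> R} = insert x {y. y < x \<and> (y, x) \<in> R}"
    using Tr_refl[OF R] Tr_le[OF R] by (auto simp: order_less_le)
  then show ?thesis by (simp add: delta_def)
qed

lemma delta_le_rank: "R \<in> Tr \<Longrightarrow> delta R x \<le> hasse_rank r x"
  by (auto simp: Tr_delta_eq_card hasse_rank_eq_card intro: card_mono)

lemma Delta_eq_card:
  assumes "R \<in> Tr"
  shows "Delta r R x = card {y. y < x \<and> (y, x) \<notin> R}"
proof -
  have "{y. y < x \<and> (y, x) \<notin> R} = {..<x} - {y. y < x \<and> (y, x) \<in> R}" by auto
  then show ?thesis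
    using assms by (simp add: Delta_def hasse_rank_eq_card Tr_delta_eq_card card_Diff_subset
        subset_iff)
qed

lemma Delta_in_M_arb:
  assumes "R \<in> Tr"
  shows "Delta r R \<in> M_arb r"
proof -
  \<comment> \<open>If y were related to x', restriction would relate it to x.\<close>
  have "{y. y < x \<and> (y, x) \<notin> R} \<subseteq> {y. y < x' \<and> (y, x') \<notin> R}" if "x \<le> x'" for x x'
    using that Tr_restrict[OF assms] by (auto simp: order_less_le)
  then have "mono (Delta r R)"
    by (intro monoI) (simp add: Delta_eq_card[OF assms] card_mono)
  then show ?thesis by (simp add: M_arb_def Delta_def)
qed

lemma Delta_antimono: "antimono_on Tr (Delta r)"
proof (rule monotone_onI)
  fix R S :: "'a rel"
  assume "R \<in> Tr" "S \<in> Tr" "R \<subseteq> S"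
  then show "Delta r R \<ge> Delta r S"
    by (auto simp: le_fun_def Delta_eq_card intro!: card_mono)
qed

section \<open>Injectivity: predecessor counts determine the transfer system\<close>

lemma Tr_eqI:
  assumes R: "R \<in> Tr" and S: "S \<in> Tr" and eq: "delta R = delta S"
  shows "R = (S :: 'a rel)"
proof -
  have "(\<forall>y. (y, x) \<in> R \<longleftrightarrow> (y, x) \<in> S)" for x
  proof (induction x rule: finite_less_induct)
    case (less x)
    let ?D = "\<lambda>R. {y. y < x \<and> (y, x) \<in> R}"
    have related_iff: "(y, x) \<in> T \<longleftrightarrow> y = x \<or> y \<in> ?D T" if "T \<in> Tr" for y T
      using Tr_refl[OF that] Tr_le[OF that, of y x] by (auto simp: order_less_le)
    \<comment> \<open>Restrict (z, x) in S' to (z, y), move it to R' by agreement at y, and compose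
      with (y, x) in R'.\<close>
    have transport: "(z, x) \<in> R'"
      if "R' \<in> Tr" "S' \<in> Tr" "(y, x) \<in> R'" "(z, x) \<in> S'" "z \<le> y" "y < x"
        "\<And>z. (z, y) \<in> S' \<longleftrightarrow> (z, y) \<in> R'" for y z and R' S' :: "'a rel"
      using that Tr_restrict[of S' z x y] Tr_trans[of R' z y x] by auto
    \<comment> \<open>If both inclusions failed, the smaller of two witnesses could be transported
      into the relation that lacks it.\<close>
    have "?D R \<subseteq> ?D S \<or> ?D S \<subseteq> ?D R"
    proof (rule ccontr)
      assume "\<not> ?thesis"
      then obtain y z where yz: "y < x" "(y, x) \<in> R" "(y, x) \<notin> S" "z < x" "(z, x) \<in> S" "(z, x) \<notin> R"
        by blast
      then have "y \<le> z \<or> z \<le> y"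
        using comparable_below[of y x z] by (simp add: less_imp_le)
      then show False
        using transport[of R S y z] transport[of S R z y] R S yz less.IH by auto
    qed
    moreover have "card (?D R) = card (?D S)"
      using fun_cong[OF eq, of x] by (simp only: Tr_delta_eq_card[OF R] Tr_delta_eq_card[OF S])
    ultimately have D_eq: "?D R = ?D S"
      by (elim disjE)
        (erule card_subset_eq[OF finite], assumption,
          rule sym, erule card_subset_eq[OF finite], rule sym, assumption)
    show ?case
    proof
      fix y
      have "(y, x) \<in> R \<longleftrightarrow> y = x \<or> y \<in> ?D R" by (rule related_iff[OF R])
      also have "\<dots> \<longleftrightarrow> y = x \<or> y \<in> ?D S" by (simp only: D_eq)
      also have "\<dots> \<longleftrightarrow> (y, x) \<in> S" by (rule related_iff[OF S, symmetric])
      finally show "(y, x) \<in> R \<longleftrightarrow> (y, x) \<in> S" .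
    qed
  qed
  then show ?thesis by auto
qed

lemma Delta_inj: "inj_on (Delta r) Tr"
proof (rule inj_onI)
  fix R S :: "'a rel"
  assume *: "R \<in> Tr" "S \<in> Tr" "Delta r R = Delta r S"
  \<comment> \<open>The bound by the rank rules out truncation, so the subtraction can be
    cancelled.\<close>
  have "delta R x = delta S x" for x
    using fun_cong[OF *(3), of x] delta_le_rank[OF *(1), of x] delta_le_rank[OF *(2), of x]
    by (simp add: Delta_def)
  with * show "R = S" by (intro Tr_eqI) auto
qed

section \<open>Surjectivity: the stack relation of a height function\<close>

definition stack_rel :: "('a \<Rightarrow> nat) \<Rightarrow> 'a rel" where
  "stack_rel d = {(y, x). y \<le> x \<and> (\<forall>w. y < w \<and> w \<le> x \<longrightarrow> d y < d w)}"

text \<open>Restriction only drops conditions on w. For transitivity, a w in (x, z] lies in (x, y]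
  or, by comparability, in (y, z], where d x \<le> d y < d w.\<close>

lemma stack_rel_in_Tr: "stack_rel d \<in> Tr"
proof -
  have "trans (stack_rel d)"
  proof (rule transI)
    fix x y z assume *: "(x, y) \<in> stack_rel d" "(y, z) \<in> stack_rel d"
    then have dxy: "d x \<le> d y" by (cases "x = y") (auto simp: stack_rel_def order_less_le)
    have "d x < d w" if w: "x < w" "w \<le> z" for w
    proof (cases "w \<le> y")
      case True
      with * w show ?thesis by (auto simp: stack_rel_def)
    next
      case False
      then have "y < w"
        using comparable_below[of w z y] * w by (auto simp: stack_rel_def less_le_not_le)
      with * w have "d y < d w" by (auto simp: stack_rel_def)
      with dxy show ?thesis by simp
    qed
    with * show "(x, z) \<in> stack_rel d" by (auto simp: stack_rel_def)
  qed
  moreover have "refl (stack_rel d)" by (auto simp: stack_rel_def intro!: refl_onI)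
  ultimately show ?thesis
    unfolding transfer_system_iff by (auto simp: stack_rel_def)
qed

text \<open>\<open>d\<close> maps the strict predecessors of x bijectively onto the levels below d
  x. As \<open>d\<close> starts at 0 and rises by at most 1 per cover, no level is skipped.\<close>

lemma delta_stack_rel:
  assumes root: "d r = 0" and step: "\<And>y w. covered_by y w \<Longrightarrow> d w \<le> Suc (d y)"
  shows "delta (stack_rel d) x = d x"
proof -
  let ?D = "{y. y < x \<and> (y, x) \<in> stack_rel d}"
  have inj: "inj_on d ?D"
  proof (rule inj_onI)
    fix y z assume *: "y \<in> ?D" "z \<in> ?D" "d y = d z"
    then have "y \<le> z \<or> z \<le> y" using comparable_below[of y x z] by auto
    with * show "y = z" by (auto simp: stack_rel_def order_less_le)
  qed
  have image: "d ` ?D = {..<d x}"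
  proof
    show "d ` ?D \<subseteq> {..<d x}" by (auto simp: stack_rel_def)
    show "{..<d x} \<subseteq> d ` ?D"
    proof
      fix k assume "k \<in> {..<d x}"
      then have k: "k < d x" by simp
      \<comment> \<open>The last point up to x of height at most k; the root, of height 0, shows
        that there is one.\<close>
      obtain y where y: "y \<le> x" "d y \<le> k"
        and ymax: "\<And>w. w \<le> x \<Longrightarrow> d w \<le> k \<Longrightarrow> y \<le> w \<Longrightarrow> y = w"
        using finite_has_maximal[of "{w. w \<le> x \<and> d w \<le> k}"] root root_le by fastforce
      have "y < x" using y k by (auto simp: order_less_le)
      have above: "k < d w" if "y < w" "w \<le> x" for w
        using ymax[of w] that by (force simp: order_less_le)
      \<comment> \<open>The next point towards x is already higher than k, so y itself has height
        exactly k.\<close>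
      obtain w where "covered_by y w" "w \<le> x" using ex_upper_cover[OF \<open>y < x\<close>] by blast
      then have "k < Suc (d y)"
        using above[of w] step[of y w] covered_by_less[of y w] by auto
      with y have "d y = k" by simp
      moreover have "y \<in> ?D"
        using \<open>y < x\<close> above y by (fastforce simp: stack_rel_def)
      ultimately show "k \<in> d ` ?D" by blast
    qed
  qed
  have "card ?D = card {..<d x}"
    using card_image[OF inj] unfolding image by (rule sym)
  then show ?thesis by (simp only: Tr_delta_eq_card[OF stack_rel_in_Tr] card_lessThan)
qed

lemma Delta_surj:
  assumes f: "f \<in> M_arb r"
  shows "f \<in> Delta r ` Tr"
proof -
  define d where "d x = hasse_rank r x - f x" for x
  have fle: "f x \<le> hasse_rank r x" for x using f by (simp add: M_arb_def)
  have "{..<r} = {}" using root_le by (auto simp: less_le_not_le)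
  then have "d r = 0" by (simp add: d_def hasse_rank_eq_card)
  \<comment> \<open>The rank rises by exactly 1 along a cover and f does not decrease.\<close>
  moreover have "d w \<le> Suc (d y)" if "covered_by y w" for y w
  proof -
    have "f y \<le> f w"
      using f that by (auto simp: M_arb_def mono_def dest: covered_by_less)
    then show ?thesis
      using card_lessThan_cover[OF that] by (simp add: d_def hasse_rank_eq_card)
  qed
  ultimately have "Delta r (stack_rel d) x = f x" for x
    using fle[of x] by (simp add: Delta_def delta_stack_rel d_def)
  then have "f = Delta r (stack_rel d)" by (simp add: fun_eq_iff)
  then show ?thesis using stack_rel_in_Tr by (rule image_eqI)
qed

end

theorem theorem4p10:
  fixes r :: "'a::{finite,order}"
  assumes "arborescence r"
  shows "(\<forall>R\<in>Tr. \<forall>x. delta R x \<le> hasse_rank r x) \<and>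
    bij_betw (Delta r) Tr (M_arb r) \<and>
    antimono_on Tr (Delta r)"
proof -
  have "Delta r ` Tr = M_arb r"
    using Delta_in_M_arb[OF assms] Delta_surj[OF assms] by blast
  then show ?thesis
    using delta_le_rank[OF assms] Delta_inj[OF assms] Delta_antimono[OF assms]
    by (simp add: bij_betw_def)
qed

end
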